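(* Let $L\subseteq\mathbb{R}^n$ be an affine subspace with $L\cap\mathbb{R}^n_+\neq\emptyset$. Let $f=(w_1,\dots,w_d)$ be a minimal FR sequence for $L\cap\mathbb{R}^n_+$, and let $(F_0,\dots,F_d)$ be its corresponding sequence of faces. Then, for every $i\in\{0,\dots,d\}$, $$L^\perp\cap F_i^\perp=\operatorname{span}\{w_1,\dots,w_i\},$$ where the span is understood to be $\{0\}$ when $i=0$.
   Context: Here the cone is $K=\mathbb{R}^n_+$, the nonnegative orthant. For a cone $F$, $F^*=\{y\mid\langle y,x\rangle\ge 0\ \forall x\in F\}$. For a set $S$, $S^\perp=\{y\mid \langle y,x\rangle=0\ \forall x\in S\}$ (also when $S$ is an affine subspace), and $w^\perp:=\{w\}^\perp$. A nonempty convex subcone $F\subseteq K$ is a face of $K$ if $x,y\in K$ and $x+y\in F$ imply $x,y\in F$. FR sequences. Facial reduction for $L\cap K$: set $F_0=K$; for $i=1,2,\dots$, as long as $L^\perp\cap(F_{i-1}^*\setminus F_{i-1}^\perp)\neq\emptyset$, choose any $w_i\in L^\perp\cap(F_{i-1}^*\setminus F_{i-1}^\perp)$ and set $F_i=F_{i-1}\cap w_i^\perp$. The procedure is run until it terminates, i.e. until $L^\perp\cap(F_d^*\setminus F_d^\perp)=\emptyset$, at which point $F_d$ is the minimal face of $L\cap K$ (the smallest face of $K$ containing $L\cap K$). The resulting $(w_1,\dots,w_d)$ is called an FR sequence for $L\cap K$, of length $d$, with corresponding sequence of faces $(F_0,\dots,F_d)$, where $F_0\supsetneq\cdots\supsetneq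 F_d$. If the procedure terminates immediately, $d=0$ (empty sequence). Minimality. For a face $F$ of $K$, a vector $w$ is minimal for $L\cap F$ if $w\in L^\perp\cap(F^*\setminus F^\perp)$ and there is no $u\in L^\perp\cap(F^*\setminus F^\perp)$ with $F\cap w^\perp\subsetneq F\cap u^\perp$. An FR sequence $(w_1,\dots,w_d)$ with faces $(F_0,\dots,F_d)$ is minimal if $w_i$ is minimal for $L\cap F_{i-1}$ for all $i=1,\dots,d$. *)

theory Defs
  imports "HOL-Analysis.Analysis"
begin

(* Annihilators S^perp are the library's orthogonal_comp, written S\<^sup>\<bottom>. It is also applied to an
   affine subspace L, where it consists of the vectors orthogonal to every point of L (and not
   merely to the direction space of L). *)

definition nonneg_orthant :: "(real ^ 'n) set" where
  "nonneg_orthant = {x. \<forall>j. 0 \<le> x $ j}"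

definition dual_cone :: "'a::real_inner set \<Rightarrow> 'a set" where
  "dual_cone F = {y. \<forall>x\<in>F. 0 \<le> y \<bullet> x}"

definition reducing_vectors :: "'a::euclidean_space set \<Rightarrow> 'a set \<Rightarrow> 'a set" where
  "reducing_vectors L F = L\<^sup>\<bottom> \<inter> (dual_cone F - F\<^sup>\<bottom>)"

(* A sequence (w_1, ..., w_d) is a list ws of length d, so that w_(i+1) is ws ! i;
   fr_face K ws i is the face F_i, meaningful for i \<le> length ws. *)
primrec fr_face :: "'a::euclidean_space set \<Rightarrow> 'a list \<Rightarrow> nat \<Rightarrow> 'a set" where
  "fr_face K ws 0 = K"
| "fr_face K ws (Suc i) = fr_face K ws i \<inter> {ws ! i}\<^sup>\<bottom>"

(* The second conjunct says that the procedure has terminated. *)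
definition fr_sequence :: "'a::euclidean_space set \<Rightarrow> 'a set \<Rightarrow> 'a list \<Rightarrow> bool" where
  "fr_sequence L K ws \<longleftrightarrow>
     (\<forall>i<length ws. ws ! i \<in> reducing_vectors L (fr_face K ws i)) \<and>
     reducing_vectors L (fr_face K ws (length ws)) = {}"

(* Only applied to faces F of a cone. *)
definition minimal_for :: "'a::euclidean_space set \<Rightarrow> 'a set \<Rightarrow> 'a \<Rightarrow> bool" where
  "minimal_for L F w \<longleftrightarrow>
     w \<in> reducing_vectors L F \<and>
     \<not> (\<exists>u \<in> reducing_vectors L F. F \<inter> {w}\<^sup>\<bottom> \<subset> F \<inter> {u}\<^sup>\<bottom>)"

definition minimal_fr_sequence :: "'a::euclidean_space set \<Rightarrow> 'a set \<Rightarrow> 'a list \<Rightarrow> bool" where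
  "minimal_fr_sequence L K ws \<longleftrightarrow>
     fr_sequence L K ws \<and> (\<forall>i<length ws. minimal_for L (fr_face K ws i) (ws ! i))"

end

theory Submission
  imports Defs
begin

text \<open>
  Every \<open>F\<^sub>i\<close> is a coordinate face: the nonnegative vectors supported in some index set \<open>A\<^sub>i\<close>. On such
  a face, membership in \<open>F\<^sub>i\<^sup>*\<close> and \<open>F\<^sub>i\<^sup>\<bottom>\<close> only concerns the entries indexed by \<open>A\<^sub>i\<close>, and passing
  to \<open>F\<^sub>i\<^sub>+\<^sub>1 = F\<^sub>i \<inter> w\<^sup>\<bottom>\<close> removes from \<open>A\<^sub>i\<close> the indices where \<open>w\<close> is positive. Minimality of \<open>w\<close> says
  that no reducing vector has a strictly smaller nonempty support in \<open>A\<^sub>i\<close>.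

  The theorem follows by induction on \<open>i\<close> from the claim that, for minimal \<open>w\<close>, the space
  \<open>L\<^sup>\<bottom> \<inter> F\<^sub>i\<^sub>+\<^sub>1\<^sup>\<bottom>\<close> is spanned by \<open>w\<close> and \<open>L\<^sup>\<bottom> \<inter> F\<^sub>i\<^sup>\<bottom>\<close> (lemma \<open>annihilator_after_minimal_step\<close>). A vector
  \<open>y\<close> of this space has its support in \<open>A\<^sub>i\<close> contained in that of \<open>w\<close>. If \<open>y\<close> is nonzero on \<open>A\<^sub>i\<close>, then,
  up to sign, it has a positive entry there, and \<open>w - t y\<close> with \<open>t\<close> the largest value that keeps it
  nonnegative on \<open>A\<^sub>i\<close> loses an index of the support of \<open>w\<close> and gains none. By minimality
  \<open>w - t y\<close> is not a reducing vector, so it vanishes on \<open>A\<^sub>i\<close>, that is, it lies in \<open>L\<^sup>\<bottom> \<inter> F\<^sub>i\<^sup>\<bottom>\<close>.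
\<close>

definition coordinate_face :: "'n set \<Rightarrow> (real ^ 'n) set" where
  "coordinate_face A = {x \<in> nonneg_orthant. \<forall>j. j \<notin> A \<longrightarrow> x $ j = 0}"

lemma axis_in_coordinate_face_iff:
  "axis j (1::real) \<in> coordinate_face A \<longleftrightarrow> j \<in> A"
  by (auto simp: coordinate_face_def nonneg_orthant_def axis_def)

lemma coordinate_face_UNIV: "coordinate_face UNIV = nonneg_orthant"
  by (simp add: coordinate_face_def)

lemma coordinate_face_psubset:
  assumes "A \<subset> B"
  shows "coordinate_face A \<subset> coordinate_face B"
proof -
  obtain k where "k \<in> B" "k \<notin> A"
    using assms by blast
  then have "axis k (1::real) \<in> coordinate_face B - coordinate_face A"
    by (simp add: axis_in_coordinate_face_iff)
  moreover have "coordinate_face A \<subseteq> coordinate_face B"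
    using assms by (auto simp: coordinate_face_def)
  ultimately show ?thesis
    by blast
qed

lemma orthogonal_comp_coordinate_face:
  fixes A :: "'n::finite set"
  shows "(coordinate_face A)\<^sup>\<bottom> = {y. \<forall>j\<in>A. y $ j = 0}"
proof (intro set_eqI iffI)
  fix y assume "y \<in> (coordinate_face A)\<^sup>\<bottom>"
  then have "axis j 1 \<bullet> y = 0" if "j \<in> A" for j
    using that by (simp add: orthogonal_comp_def orthogonal_def axis_in_coordinate_face_iff)
  then show "y \<in> {y. \<forall>j\<in>A. y $ j = 0}"
    by (simp add: inner_axis')
next
  fix y :: "real ^ 'n" assume y: "y \<in> {y. \<forall>j\<in>A. y $ j = 0}"
  have "x \<bullet> y = 0" if "x \<in> coordinate_face A" for x
    using that y unfolding inner_vec_def coordinate_face_def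
    by (intro sum.neutral) auto
  then show "y \<in> (coordinate_face A)\<^sup>\<bottom>"
    by (simp add: orthogonal_comp_def orthogonal_def)
qed

lemma dual_cone_coordinate_face:
  fixes A :: "'n::finite set"
  shows "dual_cone (coordinate_face A) = {y. \<forall>j\<in>A. 0 \<le> y $ j}"
proof (intro set_eqI iffI)
  fix y assume "y \<in> dual_cone (coordinate_face A)"
  then have "0 \<le> y \<bullet> axis j 1" if "j \<in> A" for j
    using that by (simp add: dual_cone_def axis_in_coordinate_face_iff)
  then show "y \<in> {y. \<forall>j\<in>A. 0 \<le> y $ j}"
    by (simp add: inner_axis)
next
  fix y :: "real ^ 'n" assume y: "y \<in> {y. \<forall>j\<in>A. 0 \<le> y $ j}"
  have "0 \<le> y $ j * x $ j" if "x \<in> coordinate_face A" for x j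
    using that y by (cases "j \<in> A") (auto simp: coordinate_face_def nonneg_orthant_def)
  then show "y \<in> dual_cone (coordinate_face A)"
    by (auto simp: dual_cone_def inner_vec_def intro: sum_nonneg)
qed

lemma reducing_vectors_coordinate_face:
  "w \<in> reducing_vectors L (coordinate_face A) \<longleftrightarrow>
     w \<in> L\<^sup>\<bottom> \<and> (\<forall>j\<in>A. 0 \<le> w $ j) \<and> (\<exists>j\<in>A. w $ j \<noteq> 0)"
  by (auto simp: reducing_vectors_def dual_cone_coordinate_face orthogonal_comp_coordinate_face)

text \<open>
  For \<open>x\<close> in the face all terms of \<open>w \<bullet> x\<close> are nonnegative, so the inner product vanishes only if
  each term does.
\<close>

lemma coordinate_face_Int_orthogonal_comp:
  assumes w: "\<forall>j\<in>A. 0 \<le> w $ j"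
  shows "coordinate_face A \<inter> {w}\<^sup>\<bottom> = coordinate_face {j\<in>A. w $ j = 0}"
proof (intro set_eqI iffI)
  fix x assume x: "x \<in> coordinate_face A \<inter> {w}\<^sup>\<bottom>"
  then have "(\<Sum>j\<in>UNIV. w $ j * x $ j) = 0"
    by (simp add: orthogonal_comp_def orthogonal_def inner_vec_def)
  moreover have "0 \<le> w $ j * x $ j" for j
    using x w by (cases "j \<in> A") (auto simp: coordinate_face_def nonneg_orthant_def)
  ultimately have "w $ j * x $ j = 0" for j
    by (simp add: sum_nonneg_eq_0_iff)
  then show "x \<in> coordinate_face {j\<in>A. w $ j = 0}"
    using x by (auto simp: coordinate_face_def)
next
  fix x assume x: "x \<in> coordinate_face {j\<in>A. w $ j = 0}"
  then have "w \<bullet> x = 0"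
    unfolding inner_vec_def coordinate_face_def by (intro sum.neutral) auto
  then show "x \<in> coordinate_face A \<inter> {w}\<^sup>\<bottom>"
    using x by (auto simp: coordinate_face_def orthogonal_comp_def orthogonal_def)
qed

text \<open>
  The ratio test of linear programming: the largest step from \<open>w\<close> along \<open>-y\<close> that stays
  nonnegative on \<open>A\<close> ends at a vector that vanishes on \<open>A\<close> when \<open>w\<close> has minimal support.
\<close>

lemma annihilator_after_minimal_step_pos:
  assumes min: "minimal_for L (coordinate_face A) w"
    and y: "y \<in> L\<^sup>\<bottom>" "y \<in> (coordinate_face A \<inter> {w}\<^sup>\<bottom>)\<^sup>\<bottom>"
    and pos: "\<exists>j\<in>A. 0 < y $ j"
  shows "y \<in> span (insert w (L\<^sup>\<bottom> \<inter> (coordinate_face A)\<^sup>\<bottom>))"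
proof -
  have wL: "w \<in> L\<^sup>\<bottom>" and w: "\<forall>j\<in>A. 0 \<le> w $ j"
    using min by (auto simp: minimal_for_def reducing_vectors_coordinate_face)
  have supp: "y $ j = 0" if "j \<in> A" "w $ j = 0" for j
    using y(2) that
    by (simp add: coordinate_face_Int_orthogonal_comp[OF w] orthogonal_comp_coordinate_face)
  obtain k where k: "k \<in> A" "0 < y $ k"
    and k_min: "\<And>j. j \<in> A \<Longrightarrow> 0 < y $ j \<Longrightarrow> w $ k / y $ k \<le> w $ j / y $ j"
  proof -
    let ?P = "{j\<in>A. 0 < y $ j}"
    let ?ratio = "\<lambda>j. w $ j / y $ j"
    have P: "finite ?P" "?P \<noteq> {}"
      using pos by auto
    show ?thesis
    proof (rule that)
      show "arg_min_on ?ratio ?P \<in> A" "0 < y $ arg_min_on ?ratio ?P"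
        using arg_min_if_finite(1)[OF P, of ?ratio] by simp_all
      show "?ratio (arg_min_on ?ratio ?P) \<le> ?ratio j" if "j \<in> A" "0 < y $ j" for j
        using arg_min_least[OF P, of j ?ratio] that by simp
    qed
  qed
  define t where "t = w $ k / y $ k"
  define u where "u = w - t *\<^sub>R y"
  have wk: "0 < w $ k"
    using supp[of k] k w by (metis less_eq_real_def less_irrefl)
  then have t: "0 < t"
    using k by (simp add: t_def)
  have u_nonneg: "\<forall>j\<in>A. 0 \<le> u $ j"
  proof
    fix j assume j: "j \<in> A"
    show "0 \<le> u $ j"
    proof (cases "0 < y $ j")
      case True
      then show ?thesis
        using k_min[OF j True] by (simp add: u_def t_def pos_le_divide_eq)
    next
      case False
      then have "t * y $ j \<le> 0"
        using t by (simp add: mult_nonneg_nonpos)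
      then show ?thesis
        using w j by (force simp: u_def)
    qed
  qed
  have uL: "u \<in> L\<^sup>\<bottom>"
    unfolding u_def using wL y(1)
    by (intro subspace_diff subspace_scale subspace_orthogonal_comp)
  have "u $ k = 0"
    using k by (simp add: u_def t_def)
  then have "k \<in> {j\<in>A. u $ j = 0} - {j\<in>A. w $ j = 0}"
    using wk k by simp
  moreover have "{j\<in>A. w $ j = 0} \<subseteq> {j\<in>A. u $ j = 0}"
    using supp by (auto simp: u_def)
  ultimately have "{j\<in>A. w $ j = 0} \<subset> {j\<in>A. u $ j = 0}"
    by blast
  then have "coordinate_face A \<inter> {w}\<^sup>\<bottom> \<subset> coordinate_face A \<inter> {u}\<^sup>\<bottom>"
    unfolding coordinate_face_Int_orthogonal_comp[OF w]
      coordinate_face_Int_orthogonal_comp[OF u_nonneg]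
    by (rule coordinate_face_psubset)
  then have "u \<notin> reducing_vectors L (coordinate_face A)"
    using min by (auto simp: minimal_for_def)
  then have "u \<in> L\<^sup>\<bottom> \<inter> (coordinate_face A)\<^sup>\<bottom>"
    using uL u_nonneg
    by (auto simp: reducing_vectors_coordinate_face orthogonal_comp_coordinate_face)
  then have "(1 / t) *\<^sub>R (w - u) \<in> span (insert w (L\<^sup>\<bottom> \<inter> (coordinate_face A)\<^sup>\<bottom>))"
    by (intro span_scale span_diff span_base) auto
  then show ?thesis
    using t by (simp add: u_def)
qed

text \<open>
  Negation preserves both sides, so a \<open>y\<close> that is nonzero on \<open>A\<close> can be given a positive entry there.
\<close>

lemma annihilator_after_minimal_step:
  assumes min: "minimal_for L (coordinate_face A) w"
  shows "L\<^sup>\<bottom> \<inter> (coordinate_face A \<inter> {w}\<^sup>\<bottom>)\<^sup>\<bottom> = span (insert w (L\<^sup>\<bottom> \<inter> (coordinate_face A)\<^sup>\<bottom>))"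
    (is "?V = span (insert w ?U)")
proof
  have V: "subspace ?V"
    by (intro subspace_inter subspace_orthogonal_comp)
  have "w \<in> ?V"
    using min by (auto simp: minimal_for_def reducing_vectors_def orthogonal_comp_def
        orthogonal_commute)
  moreover have "?U \<subseteq> ?V"
    by (auto simp: orthogonal_comp_def)
  ultimately show "span (insert w ?U) \<subseteq> ?V"
    by (intro span_minimal V) simp
  show "?V \<subseteq> span (insert w ?U)"
  proof
    fix y assume y: "y \<in> ?V"
    then have neg: "- y \<in> ?V"
      by (rule subspace_neg[OF V])
    consider "\<exists>j\<in>A. 0 < y $ j" | "\<exists>j\<in>A. 0 < (- y) $ j" | "\<forall>j\<in>A. y $ j = 0"
      by (force simp: not_less)
    then show "y \<in> span (insert w ?U)"
    proof cases
      case 1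
      then show ?thesis
        using annihilator_after_minimal_step_pos[OF min] y by blast
    next
      case 2
      then have "- y \<in> span (insert w ?U)"
        using annihilator_after_minimal_step_pos[OF min] neg by blast
      then show ?thesis
        using span_neg by fastforce
    next
      case 3
      then have "y \<in> ?U"
        using y by (simp add: orthogonal_comp_coordinate_face)
      then show ?thesis
        by (simp add: span_base)
    qed
  qed
qed

lemma fr_face_is_coordinate_face:
  fixes L :: "(real ^ 'n) set"
  assumes "fr_sequence L nonneg_orthant ws" and "i \<le> length ws"
  shows "\<exists>A. fr_face nonneg_orthant ws i = coordinate_face A"
  using assms(2)
proof (induction i)
  case 0
  show ?case
    using coordinate_face_UNIV by auto
next
  case (Suc i)
  then obtain A where A: "fr_face nonneg_orthant ws i = coordinate_face A"
    by auto
  moreover have "ws ! i \<in> reducing_vectors L (fr_face nonneg_orthant ws i)"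
    using assms(1) Suc.prems by (simp add: fr_sequence_def)
  ultimately have "\<forall>j\<in>A. 0 \<le> ws ! i $ j"
    by (simp add: reducing_vectors_coordinate_face)
  from coordinate_face_Int_orthogonal_comp[OF this] show ?case
    using A by auto
qed

theorem corollary4p2:
  fixes L :: "(real ^ 'n) set" and ws :: "(real ^ 'n) list" and i :: nat
  assumes "affine L"
    and "L \<inter> nonneg_orthant \<noteq> {}"
    and "minimal_fr_sequence L nonneg_orthant ws"
    and "i \<le> length ws"
  shows "L\<^sup>\<bottom> \<inter> (fr_face nonneg_orthant ws i)\<^sup>\<bottom> = span (set (take i ws))"
  using assms(4)
proof (induction i)
  case 0
  have "(nonneg_orthant :: (real ^ 'n) set)\<^sup>\<bottom> = {0}"
    unfolding coordinate_face_UNIV[symmetric] orthogonal_comp_coordinate_face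
    by (auto simp: vec_eq_iff)
  then show ?case
    by (auto simp: subspace_0 subspace_orthogonal_comp)
next
  case (Suc i)
  let ?F = "fr_face nonneg_orthant ws i"
  obtain A where A: "?F = coordinate_face A"
    using fr_face_is_coordinate_face assms(3) Suc.prems
    by (metis Suc_leD minimal_fr_sequence_def)
  have "minimal_for L ?F (ws ! i)"
    using assms(3) Suc.prems by (simp add: minimal_fr_sequence_def)
  then have "L\<^sup>\<bottom> \<inter> (?F \<inter> {ws ! i}\<^sup>\<bottom>)\<^sup>\<bottom> = span (insert (ws ! i) (L\<^sup>\<bottom> \<inter> ?F\<^sup>\<bottom>))"
    unfolding A by (rule annihilator_after_minimal_step)
  also have "\<dots> = span (insert (ws ! i) (span (set (take i ws))))"
    using Suc by simp
  also have "\<dots> = span (insert (ws ! i) (set (take i ws)))"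
    by (auto simp: set_eq_iff span_breakdown_eq span_span)
  also have "insert (ws ! i) (set (take i ws)) = set (take (Suc i) ws)"
    using Suc.prems by (simp add: take_Suc_conv_app_nth)
  finally show ?case
    by simp
qed

end
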